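(* Let $A$ be a discrete valuation ring with fraction field $F$ and uniformizer $\pi$. Then the matrix $$M_\pi=\begin{pmatrix} 1-\tfrac{1}{\pi}(X-1)(Y-1) & \tfrac{1}{\pi}(Y-1)^2\\ -\tfrac{1}{\pi}(X-1)^2 & 1+\tfrac{1}{\pi}(X-1)(Y-1)\end{pmatrix}\in \mathrm{SL}_2(F[X^{\pm1},Y^{\pm1}])$$ does not belong to $\mathrm{E}_2(F[X^{\pm1},Y^{\pm1}])$.
   Context: $F[X^{\pm1},Y^{\pm1}]$ is the ring of Laurent polynomials in two variables over $F$. For a commutative ring $R$, $\mathrm{E}_2(R)$ denotes the subgroup of $\mathrm{SL}_2(R)$ generated by the elementary matrices $e_{12}(r)=\begin{pmatrix} 1 & r \\ 0 & 1 \end{pmatrix}$ and $e_{21}(r)=\begin{pmatrix} 1 & 0 \\ r & 1 \end{pmatrix}$, $r\in R$. *)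

theory Defs
  imports
    "HOL-Analysis.Analysis"
    "HOL-Algebra.Algebraic_Closure_Type"
    "HOL-Algebra.Ring_Divisibility"
    "HOL-Algebra.Generated_Groups"
    "HOL-Library.Poly_Mapping"
begin

no_notation fps_nth (infixl "$" 75)

text \<open>A discrete valuation ring is a principal ideal domain, not a field, with exactly one
  maximal ideal; its uniformizers are the generators of that ideal.\<close>

definition discrete_valuation_ring :: "('a, 'b) ring_scheme \<Rightarrow> bool" where
  "discrete_valuation_ring R \<longleftrightarrow>
     principal_domain R \<and> \<not> field R \<and> (\<exists>!M. maximalideal M R)"

definition uniformizer :: "('a, 'b) ring_scheme \<Rightarrow> 'a \<Rightarrow> bool" where
  "uniformizer R \<pi> \<longleftrightarrow> \<pi> \<in> carrier R \<and> maximalideal (PIdl\<^bsub>R\<^esub> \<pi>) R"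

text \<open>Finitely supported functions on \<open>\<int> \<times> \<int>\<close> with the convolution product of
  \<open>Poly_Mapping\<close>: the value at \<open>(i, j)\<close> is the coefficient of \<open>X\<^sup>i Y\<^sup>j\<close>.\<close>

type_synonym 'f laurent2 = "(int \<times> int) \<Rightarrow>\<^sub>0 'f"

definition lconst :: "'f::field \<Rightarrow> 'f laurent2" where
  "lconst c = Poly_Mapping.single (0, 0) c"

definition lX :: "'f::field laurent2" where
  "lX = Poly_Mapping.single (1, 0) 1"

definition lY :: "'f::field laurent2" where
  "lY = Poly_Mapping.single (0, 1) 1"

definition mat2 :: "'r \<Rightarrow> 'r \<Rightarrow> 'r \<Rightarrow> 'r \<Rightarrow> 'r::zero ^ 2 ^ 2" where
  "mat2 a b c d = vector [vector [a, b], vector [c, d]]"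

definition SL2 :: "('r::comm_ring_1 ^ 2 ^ 2) monoid" where
  "SL2 = \<lparr>carrier = {M. det M = 1}, monoid.mult = (**), one = mat 1\<rparr>"

definition e12 :: "'r \<Rightarrow> 'r::comm_ring_1 ^ 2 ^ 2" where
  "e12 r = mat2 1 r 0 1"

definition e21 :: "'r \<Rightarrow> 'r::comm_ring_1 ^ 2 ^ 2" where
  "e21 r = mat2 1 0 r 1"

definition E2 :: "('r::comm_ring_1 ^ 2 ^ 2) set" where
  "E2 = generate SL2 (range e12 \<union> range e21)"

lemma group_SL2: "group (SL2 :: ('r::comm_ring_1 ^ 2 ^ 2) monoid)"
proof (rule groupI)
  fix M :: "'r ^ 2 ^ 2" assume "M \<in> carrier SL2"
  then have d: "M $ 1 $ 1 * M $ 2 $ 2 - M $ 1 $ 2 * M $ 2 $ 1 = 1"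
    by (simp add: SL2_def det_2)
  let ?N = "mat2 (M $ 2 $ 2) (- M $ 1 $ 2) (- M $ 2 $ 1) (M $ 1 $ 1)"
  have "?N ** M = mat 1" "det ?N = 1"
    using d by (simp_all add: mat2_def det_2 matrix_matrix_mult_def mat_def vec_eq_iff
        forall_2 sum_2 algebra_simps)
  then show "\<exists>N\<in>carrier SL2. N \<otimes>\<^bsub>SL2\<^esub> M = \<one>\<^bsub>SL2\<^esub>"
    by (auto simp: SL2_def)
qed (auto simp: SL2_def det_mul matrix_mul_assoc)

lemma generators_in_SL2: "range e12 \<union> range e21 \<subseteq> carrier SL2"
  by (auto simp: SL2_def e12_def e21_def mat2_def det_2)

definition M_pi :: "'a::idom \<Rightarrow> 'a fract laurent2 ^ 2 ^ 2" where
  "M_pi \<pi> = (let s = lconst (Fraction_Field.Fract 1 \<pi>) in mat2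
     (1 - s * (lX - 1) * (lY - 1))   (s * (lY - 1)^2)
     (- s * (lX - 1)^2)              (1 + s * (lX - 1) * (lY - 1)))"

end

theory Submission
  imports Defs
begin

text \<open>Write \<open>L = A[X\<^sup>\<plusminus>, Y\<^sup>\<plusminus>]\<close>, so that \<open>F[X\<^sup>\<plusminus>, Y\<^sup>\<plusminus>] = L[1/\<pi>]\<close> and \<open>\<pi>\<close> is prime in \<open>L\<close>, and let
  \<open>E\<^sub>2\<close> act on the Bruhat--Tits tree of the Gauss valuation. Up to scalars \<open>\<pi>\<^sup>k\<close> every element of
  \<open>E\<^sub>2(L[1/\<pi>])\<close> is a product of matrices in \<open>SL\<^sub>2(L)\<close> and copies of \<open>D = diag(\<pi>, 1)\<close>. Since
  \<open>\<pi>\<close> is prime, cancelling the backtracking factors \<open>D P D \<in> \<pi> SL\<^sub>2(L)\<close> leaves a product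
  \<open>P\<^sub>0 D P\<^sub>1 D \<dots> P\<^sub>n\<close> that is nonzero modulo \<open>\<pi>\<close>; if \<open>n > 0\<close>, all its columns are modulo \<open>\<pi>\<close>
  multiples of the second column \<open>(x, y)\<close> of \<open>P\<^sub>0\<close>, which is unimodular. The matrix \<open>\<pi> M\<^sub>\<pi>\<close> has
  determinant \<open>\<pi>\<^sup>2\<close> and is modulo \<open>\<pi>\<close> the product of the column \<open>(Y - 1, X - 1)\<close> with a row, so
  membership in \<open>E\<^sub>2\<close> would give \<open>y (Y - 1) \<equiv> x (X - 1)\<close> modulo \<open>\<pi>\<close>. Differentiating at
  \<open>(1, 1)\<close> shows that \<open>x\<close> and \<open>y\<close> both vanish there modulo \<open>\<pi>\<close>, contradicting unimodularity.\<close>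

subsection \<open>Matrices reduced at a prime\<close>

lemma mat2_nth [simp]:
  "mat2 a b c d $ 1 $ 1 = a" "mat2 a b c d $ 1 $ 2 = b"
  "mat2 a b c d $ 2 $ 1 = c" "mat2 a b c d $ 2 $ 2 = d"
  by (simp_all add: mat2_def)

lemma matrix_mult_2_nth:
  fixes M N :: "'r::semiring_1 ^ 2 ^ 2"
  shows "(M ** N) $ i $ j = M $ i $ 1 * N $ 1 $ j + M $ i $ 2 * N $ 2 $ j"
  by (simp add: matrix_matrix_mult_def sum_2)

lemma mat_2_nth [simp]:
  "mat c $ (1::2) $ (1::2) = c" "mat c $ (1::2) $ (2::2) = 0"
  "mat c $ (2::2) $ (1::2) = 0" "mat c $ (2::2) $ (2::2) = c"
  by (simp_all add: mat_def)

lemma mat_mult_nth: "(mat c ** N) $ i $ j = c * (N::'r::comm_ring_1 ^ 2 ^ 2) $ i $ j"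
  using exhaust_2[of i] by (auto simp: matrix_mult_2_nth)

lemma mat_mult_commute: "N ** mat c = mat c ** (N::'r::comm_ring_1 ^ 2 ^ 2)"
  by (simp add: vec_eq_iff forall_2 matrix_mult_2_nth mult.commute)

lemma mat_mult_mat: "mat a ** mat b = (mat (a * b) :: 'r::comm_ring_1 ^ 2 ^ 2)"
  by (simp add: vec_eq_iff forall_2 matrix_mult_2_nth)

text \<open>Up to powers of \<open>p\<close>, these are the products \<open>P\<^sub>0 D P\<^sub>1 D \<dots> P\<^sub>n\<close> with \<open>D = diag(p, 1)\<close> in
  which no factor \<open>D P\<^sub>i D\<close> is divisible by \<open>p\<close>, that is, the non-backtracking paths
  in the Bruhat--Tits tree.\<close>

inductive reduced :: "'r::comm_ring_1 \<Rightarrow> 'r ^ 2 ^ 2 \<Rightarrow> bool" for p where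
  base: "det P = 1 \<Longrightarrow> reduced p P"
| step: "\<lbrakk>det P = 1; reduced p N; \<not> (p dvd N $ 2 $ 1 \<and> p dvd N $ 2 $ 2)\<rbrakk>
    \<Longrightarrow> reduced p (P ** (mat2 p 0 0 1 ** N))"

lemma reduced_SL2_mult:
  assumes "reduced p N" "det Q = 1" shows "reduced p (Q ** N)"
  using assms(1)
proof cases
  case base
  then show ?thesis using assms by (simp add: reduced.base det_mul)
next
  case (step P N')
  then show ?thesis using assms reduced.step[of "Q ** P" p N']
    by (simp add: det_mul matrix_mul_assoc)
qed

text \<open>Modulo \<open>p\<close> the product \<open>P D N'\<close> is the second column of
  \<open>P\<close> times the second row of \<open>N'\<close>. That row is nonzero modulo the prime
  \<open>p\<close>, so if the product vanished, \<open>p\<close> would divide a column of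
  \<open>P\<close> and hence \<open>det P = 1\<close>.\<close>

lemma reduced_not_dvd:
  assumes "prime_elem p" "reduced p N" shows "\<exists>i j. \<not> p dvd N $ i $ j"
proof (rule ccontr)
  assume "\<not> (\<exists>i j. \<not> p dvd N $ i $ j)"
  then have dvd: "p dvd N $ i $ j" for i j by blast
  from assms(2) show False
  proof cases
    case base
    have "p dvd det N" using dvd by (simp add: det_2)
    then show False using base assms(1) by (simp add: prime_elem_def)
  next
    case (step P N')
    obtain j where j: "\<not> p dvd N' $ 2 $ j" using step by blast
    have "p dvd P $ i $ 2 * N' $ 2 $ j" for i
    proof -
      have "N $ i $ j = p * (P $ i $ 1 * N' $ 1 $ j) + P $ i $ 2 * N' $ 2 $ j"
        by (simp add: step matrix_mult_2_nth algebra_simps)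
      then show ?thesis using dvd[of i j] by (simp add: dvd_add_right_iff)
    qed
    then have "p dvd P $ i $ 2" for i
      using j assms(1) prime_elem_dvd_mult_iff by blast
    then have "p dvd det P" by (simp add: det_2)
    then show False using step assms(1) by (simp add: prime_elem_def)
  qed
qed

text \<open>Either \<open>D N\<close> is a longer path or the path backtracks: if
  \<open>N = P D N1\<close> has its bottom row divisible by \<open>p\<close>, then \<open>p\<close>
  divides \<open>P $ 2 $ 2\<close> and \<open>D P D = p Q\<close> with
  \<open>det Q = 1\<close>.\<close>

lemma reduced_diag_mult:
  assumes "prime_elem p" "reduced p N"
  shows "\<exists>k N'. reduced p N' \<and> mat2 p 0 0 1 ** N = mat (p ^ k) ** N'"
proof (cases "p dvd N $ 2 $ 1 \<and> p dvd N $ 2 $ 2")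
  case False
  then have "reduced p (mat 1 ** (mat2 p 0 0 1 ** N))"
    using assms by (intro reduced.step) auto
  then have "reduced p (mat2 p 0 0 1 ** N) \<and> mat2 p 0 0 1 ** N = mat (p ^ 0) ** (mat2 p 0 0 1 ** N)"
    by simp
  then show ?thesis by blast
next
  case True
  from assms(2) show ?thesis
  proof cases
    case base
    have "p dvd det N" using True by (simp add: det_2)
    then show ?thesis using base assms(1) by (simp add: prime_elem_def)
  next
    case (step P N1)
    obtain j where j: "\<not> p dvd N1 $ 2 $ j" using step by blast
    have "N $ 2 $ j = p * (P $ 2 $ 1 * N1 $ 1 $ j) + P $ 2 $ 2 * N1 $ 2 $ j"
      by (simp add: step matrix_mult_2_nth algebra_simps)
    moreover have "p dvd N $ 2 $ j" using True exhaust_2[of j] by auto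
    ultimately have "p dvd P $ 2 $ 2" using j assms(1)
      by (simp add: dvd_add_right_iff prime_elem_dvd_mult_iff)
    then obtain e where e: "P $ 2 $ 2 = p * e" by (elim dvdE)
    let ?Q = "mat2 (p * P $ 1 $ 1) (P $ 1 $ 2) (P $ 2 $ 1) e"
    have "det ?Q = 1" using step(2) e by (simp add: det_2 algebra_simps)
    then have "reduced p (?Q ** N1)" using step by (simp add: reduced_SL2_mult)
    moreover have "mat2 p 0 0 1 ** N = mat (p ^ 1) ** (?Q ** N1)"
      by (simp add: step vec_eq_iff forall_2 matrix_mult_2_nth e algebra_simps)
    ultimately show ?thesis by blast
  qed
qed

section \<open>Left multiplication by generators cleared of denominators\<close>

definition keeps_reduced :: "'r::comm_ring_1 \<Rightarrow> 'r ^ 2 ^ 2 \<Rightarrow> bool" where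
  "keeps_reduced p G \<longleftrightarrow>
     (\<forall>N. reduced p N \<longrightarrow> (\<exists>k N'. reduced p N' \<and> G ** N = mat (p ^ k) ** N'))"

lemma keeps_reduced_SL2: "det P = 1 \<Longrightarrow> keeps_reduced p P"
  unfolding keeps_reduced_def by (metis matrix_mul_lid power_0 reduced_SL2_mult)

lemma keeps_reduced_mult:
  assumes "keeps_reduced p G" "keeps_reduced p H" shows "keeps_reduced p (G ** H)"
  unfolding keeps_reduced_def
proof (intro allI impI)
  fix N assume "reduced p N"
  then obtain k N1 where 1: "reduced p N1" "H ** N = mat (p ^ k) ** N1"
    using assms unfolding keeps_reduced_def by blast
  then obtain l N2 where 2: "reduced p N2" "G ** N1 = mat (p ^ l) ** N2"
    using assms unfolding keeps_reduced_def by blast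
  have "(G ** H) ** N = (G ** mat (p ^ k)) ** N1"
    by (simp add: 1 flip: matrix_mul_assoc)
  also have "\<dots> = mat (p ^ k) ** (G ** N1)"
    by (simp add: mat_mult_commute matrix_mul_assoc)
  also have "\<dots> = mat (p ^ (k + l)) ** N2"
    by (simp add: 2 matrix_mul_assoc mat_mult_mat power_add)
  finally show "\<exists>k N'. reduced p N' \<and> (G ** H) ** N = mat (p ^ k) ** N'"
    using 2 by blast
qed

lemma keeps_reduced_diag_1:
  assumes "prime_elem p" shows "keeps_reduced p (mat2 (p ^ n) 0 0 1)"
proof (induction n)
  case 0
  show ?case by (simp add: keeps_reduced_SL2 det_2)
next
  case (Suc n)
  have "keeps_reduced p (mat2 p 0 0 1)"
    using reduced_diag_mult[OF assms] by (simp add: keeps_reduced_def)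
  moreover have "mat2 (p ^ Suc n) 0 0 1 = mat2 p 0 0 1 ** mat2 (p ^ n) 0 0 1"
    by (simp add: vec_eq_iff forall_2 matrix_mult_2_nth)
  ultimately show ?case using Suc by (simp add: keeps_reduced_mult)
qed

lemma keeps_reduced_diag_2:
  assumes "prime_elem p" shows "keeps_reduced p (mat2 1 0 0 (p ^ n))"
proof -
  \<comment> \<open>Conjugation by a rotation of determinant 1 exchanges the diagonal
    entries.\<close>
  have "mat2 1 0 0 (p ^ n) = mat2 0 1 (-1) 0 ** (mat2 (p ^ n) 0 0 1 ** mat2 0 (-1) 1 0)"
    by (simp add: vec_eq_iff forall_2 matrix_mult_2_nth)
  then show ?thesis
    by (simp add: keeps_reduced_mult keeps_reduced_SL2 keeps_reduced_diag_1[OF assms] det_2)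
qed

text \<open>These are the generators with parameter \<open>s / p ^ n\<close>, multiplied by
  \<open>p ^ n\<close>. The scalar is split into two diagonal factors placed around an elementary
  matrix with entry \<open>s\<close>.\<close>

lemma keeps_reduced_elementary:
  assumes "prime_elem p"
  shows "keeps_reduced p (mat2 (p ^ n) s 0 (p ^ n))" "keeps_reduced p (mat2 (p ^ n) 0 s (p ^ n))"
proof -
  have "mat2 (p ^ n) s 0 (p ^ n)
      = mat2 1 0 0 (p ^ n) ** (mat2 1 s 0 1 ** mat2 (p ^ n) 0 0 1)"
    "mat2 (p ^ n) 0 s (p ^ n) = mat2 (p ^ n) 0 0 1 ** (mat2 1 0 s 1 ** mat2 1 0 0 (p ^ n))"
    by (simp_all add: vec_eq_iff forall_2 matrix_mult_2_nth)
  then show "keeps_reduced p (mat2 (p ^ n) s 0 (p ^ n))"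
    "keeps_reduced p (mat2 (p ^ n) 0 s (p ^ n))"
    by (simp_all add: keeps_reduced_mult keeps_reduced_SL2 keeps_reduced_diag_1[OF assms]
        keeps_reduced_diag_2[OF assms] det_2)
qed

lemma inv_elementary:
  assumes "g \<in> range e12 \<union> range e21"
  shows "inv\<^bsub>SL2\<^esub> g \<in> range e12 \<union> range e21"
proof -
  have "inv\<^bsub>SL2\<^esub> (e12 r) = e12 (- r)" for r :: 'a
    by (rule group.inv_equality[OF group_SL2])
      (simp_all add: SL2_def e12_def vec_eq_iff forall_2 matrix_mult_2_nth det_2)
  moreover have "inv\<^bsub>SL2\<^esub> (e21 r) = e21 (- r)" for r :: 'a
    by (rule group.inv_equality[OF group_SL2])
      (simp_all add: SL2_def e21_def vec_eq_iff forall_2 matrix_mult_2_nth det_2)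
  ultimately show ?thesis using assms by (elim UnE rangeE) simp_all
qed

section \<open>Descent from the ring with \<open>p\<close> inverted\<close>

definition map_mat :: "('l \<Rightarrow> 'r) \<Rightarrow> 'l ^ 2 ^ 2 \<Rightarrow> 'r ^ 2 ^ 2" where
  "map_mat f M = (\<chi> i j. f (M $ i $ j))"

lemma map_mat_nth [simp]: "map_mat f M $ i $ j = f (M $ i $ j)"
  by (simp add: map_mat_def)

text \<open>Models the embedding of L into L[1/p]. The rings are merely commutative, so
  \<open>cancel\<close> states that \<open>p\<close> is not a zero divisor.\<close>

locale localization_hom =
  fixes \<iota> :: "'l::comm_ring_1 \<Rightarrow> 'r::comm_ring_1" and p :: 'l
  assumes add: "\<iota> (a + b) = \<iota> a + \<iota> b"
    and mult: "\<iota> (a * b) = \<iota> a * \<iota> b"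
    and one: "\<iota> 1 = 1"
    and inj: "inj \<iota>"
    and denominator: "\<exists>n s. \<iota> p ^ n * r = \<iota> s"
    and prime: "prime_elem p"
    and cancel: "p * a = p * b \<Longrightarrow> a = b"
begin

lemma zero: "\<iota> 0 = 0"
  using add[of 0 0] by simp

lemma power: "\<iota> (a ^ n) = \<iota> a ^ n"
  by (induction n) (simp_all add: one mult)

lemma cancel_power: "p ^ n * a = p ^ n * b \<Longrightarrow> a = b"
  by (induction n) (auto simp: mult.assoc dest: cancel)

lemma map_mat_mult: "map_mat \<iota> (M ** N) = map_mat \<iota> M ** map_mat \<iota> N"
  by (simp add: vec_eq_iff matrix_mult_2_nth add mult)

text \<open>Encodes \<open>h = p^(k - i) N\<close>, where the exponent may have either sign.\<close>

definition reducible_to :: "'r ^ 2 ^ 2 \<Rightarrow> 'l ^ 2 ^ 2 \<Rightarrow> bool" where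
  "reducible_to h N \<longleftrightarrow> (\<exists>i k. mat (\<iota> p ^ i) ** h = map_mat \<iota> (mat (p ^ k) ** N))"

lemma reducible_to_mult:
  assumes "reducible_to h N" "reduced p N" "keeps_reduced p G" "mat (\<iota> p ^ n) ** g = map_mat \<iota> G"
  shows "\<exists>N'. reduced p N' \<and> reducible_to (g ** h) N'"
proof -
  obtain i k where ik: "mat (\<iota> p ^ i) ** h = map_mat \<iota> (mat (p ^ k) ** N)"
    using assms unfolding reducible_to_def by blast
  obtain l N' where N': "reduced p N'" "G ** N = mat (p ^ l) ** N'"
    using assms unfolding keeps_reduced_def by blast
  have "mat (\<iota> p ^ (n + i)) ** (g ** h) = mat (\<iota> p ^ n) ** (mat (\<iota> p ^ i) ** g) ** h"
    by (simp add: power_add matrix_mul_assoc mat_mult_mat)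
  also have "\<dots> = mat (\<iota> p ^ n) ** (g ** mat (\<iota> p ^ i)) ** h"
    by (simp only: mat_mult_commute)
  also have "\<dots> = (mat (\<iota> p ^ n) ** g) ** (mat (\<iota> p ^ i) ** h)"
    by (simp only: matrix_mul_assoc)
  also have "\<dots> = map_mat \<iota> (G ** mat (p ^ k) ** N)"
    by (simp add: ik assms map_mat_mult matrix_mul_assoc)
  also have "G ** mat (p ^ k) ** N = mat (p ^ k) ** (G ** N)"
    by (simp add: mat_mult_commute matrix_mul_assoc)
  also have "\<dots> = mat (p ^ (k + l)) ** N'"
    by (simp add: N' power_add matrix_mul_assoc mat_mult_mat)
  finally show ?thesis using N' unfolding reducible_to_def by blast
qed

lemma elementary_reducible_to:
  assumes "g \<in> range e12 \<union> range e21" "reduced p N" "reducible_to h N"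
  shows "\<exists>N'. reduced p N' \<and> reducible_to (g ** h) N'"
proof -
  obtain r where r: "g = e12 r \<or> g = e21 r" using assms by auto
  obtain n s where s: "\<iota> p ^ n * r = \<iota> s" using denominator by blast
  have g: "mat (\<iota> p ^ n) ** e12 r = map_mat \<iota> (mat2 (p ^ n) s 0 (p ^ n))"
    "mat (\<iota> p ^ n) ** e21 r = map_mat \<iota> (mat2 (p ^ n) 0 s (p ^ n))"
    by (simp_all add: vec_eq_iff forall_2 matrix_mult_2_nth e12_def e21_def s zero power)
  show ?thesis
    using r reducible_to_mult[OF assms(3,2) keeps_reduced_elementary(1)[OF prime] g(1)]
      reducible_to_mult[OF assms(3,2) keeps_reduced_elementary(2)[OF prime] g(2)]
    by (elim disjE) simp_all
qed

lemma E2_reducible_to: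
  assumes "h \<in> E2"
  shows "\<exists>N. reduced p N \<and> reducible_to h N"
proof -
  \<comment> \<open>The right factor \<open>g\<close> must be arbitrary for the induction: in a
    product, \<open>h2\<close> acts on \<open>g\<close> first and then \<open>h1\<close> acts on
    \<open>h2 ** g\<close>.\<close>
  have "\<exists>N'. reduced p N' \<and> reducible_to (h ** g) N'"
    if "reduced p N" "reducible_to g N" for g N
    using assms that unfolding E2_def
  proof (induction arbitrary: g N)
    case one
    then show ?case by (intro exI[of _ N]) (simp add: SL2_def)
  next
    case (incl h)
    then show ?case by (rule elementary_reducible_to)
  next
    case (inv h)
    show ?case using inv_elementary[OF inv(1)] inv(2,3) by (rule elementary_reducible_to)
  next
    case (eng h1 h2)
    obtain N' where "reduced p N'" "reducible_to (h2 ** g) N'"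
      using eng.IH(2)[OF eng.prems] by blast
    from eng.IH(1)[OF this] show ?case by (simp add: SL2_def matrix_mul_assoc)
  qed
  moreover have "reduced p (mat 1)" by (simp add: reduced.base)
  moreover have "mat (\<iota> p ^ 0) ** mat 1 = map_mat \<iota> (mat (p ^ 0) ** mat 1)"
    by (simp add: vec_eq_iff forall_2 one zero)
  then have "reducible_to (mat 1) (mat 1)" unfolding reducible_to_def by blast
  ultimately have "\<exists>N'. reduced p N' \<and> reducible_to (h ** mat 1) N'" .
  then show ?thesis by simp
qed

text \<open>\<open>H\<close> and the reduced \<open>N\<close> obtained from \<open>h\<close> agree
  up to a power of \<open>p\<close>. Neither is divisible by \<open>p\<close>, so the power is
  trivial and \<open>H = N\<close>.\<close>

lemma E2_primitive_reduced:
  assumes "h \<in> E2" "mat (\<iota> p ^ m) ** h = map_mat \<iota> H" "\<not> p dvd H $ i $ j"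
  shows "reduced p H"
proof -
  obtain N a k where N: "reduced p N" "mat (\<iota> p ^ a) ** h = map_mat \<iota> (mat (p ^ k) ** N)"
    using E2_reducible_to[OF assms(1)] unfolding reducible_to_def by blast
  have "map_mat \<iota> (mat (p ^ a) ** H) = mat (\<iota> p ^ a) ** map_mat \<iota> H"
    by (simp add: vec_eq_iff mat_mult_nth mult power)
  also have "\<dots> = mat (\<iota> p ^ m) ** (mat (\<iota> p ^ a) ** h)"
    by (simp add: matrix_mul_assoc mat_mult_mat mult.commute flip: assms(2))
  also have "\<dots> = map_mat \<iota> (mat (p ^ (m + k)) ** N)"
    by (simp add: N vec_eq_iff mat_mult_nth mult power power_add mult.assoc)
  finally have eq: "p ^ a * H $ i $ j = p ^ (m + k) * N $ i $ j" for i j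
    using inj by (simp add: vec_eq_iff mat_mult_nth inj_eq)
  have "a = m + k"
  proof (rule ccontr)
    assume "a \<noteq> m + k"
    then consider d where "a = m + k + Suc d" | d where "m + k = a + Suc d"
      by (metis less_imp_Suc_add linorder_neqE_nat add_Suc_right)
    then show False
    proof cases
      case 1
      then have "p ^ (m + k) * N $ i $ j = p ^ (m + k) * (p ^ Suc d * H $ i $ j)" for i j
        using eq[of i j] by (simp only: power_add mult.assoc)
      from cancel_power[OF this] have "p dvd N $ i $ j" for i j
        by simp
      then show False using reduced_not_dvd[OF prime N(1)] by blast
    next
      case 2
      then have "p ^ a * H $ i $ j = p ^ a * (p ^ Suc d * N $ i $ j)"
        using eq[of i j] by (simp only: power_add mult.assoc)
      from cancel_power[OF this] show False using assms(3) by simp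
    qed
  qed
  with eq have "H $ i $ j = N $ i $ j" for i j using cancel_power by blast
  then have "H = N" by (simp add: vec_eq_iff)
  then show ?thesis using N by simp
qed

end

text \<open>If \<open>H = P D N\<close> with \<open>det P = 1\<close>, then modulo \<open>p\<close> it is the second column \<open>(x, y)\<close> of
  \<open>P\<close> times the second row of \<open>N\<close>.\<close>

lemma reduced_unimodular_column:
  assumes "reduced p H" "det H \<noteq> 1"
  obtains x y z w where "x * z + y * w = 1"
    and "\<And>j. p dvd y * H $ 1 $ j - x * H $ 2 $ j"
  using assms(1)
proof cases
  case base
  then show ?thesis using assms by simp
next
  case (step P N)
  show ?thesis
  proof (rule that)
    \<comment> \<open>The witnesses \<open>z\<close> and \<open>w\<close> are cofactors, making
      \<open>x * z + y * w\<close> equal to \<open>det P\<close>.\<close>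
    show "P $ 1 $ 2 * (- P $ 2 $ 1) + P $ 2 $ 2 * P $ 1 $ 1 = 1"
      using step by (simp add: det_2 algebra_simps)
    fix j
    \<comment> \<open>The contributions of the second row of \<open>N\<close> cancel; those of the
      first row carry the factor \<open>p\<close> from \<open>D\<close>.\<close>
    have "P $ 2 $ 2 * H $ 1 $ j - P $ 1 $ 2 * H $ 2 $ j
        = p * (N $ 1 $ j * (P $ 2 $ 2 * P $ 1 $ 1 - P $ 1 $ 2 * P $ 2 $ 1))"
      by (simp add: step matrix_mult_2_nth algebra_simps)
    then show "p dvd P $ 2 $ 2 * H $ 1 $ j - P $ 1 $ 2 * H $ 2 $ j" by simp
  qed
qed

subsection \<open>Discrete valuation rings\<close>

lemma ring_of_type_algebra_simps:
  fixes x y :: "'a::comm_ring_1"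
  shows "carrier (ring_of_type_algebra :: 'a ring) = UNIV" "x \<otimes>\<^bsub>ring_of_type_algebra\<^esub> y = x * y"
    "\<one>\<^bsub>ring_of_type_algebra\<^esub> = (1 :: 'a)" "\<zero>\<^bsub>ring_of_type_algebra\<^esub> = (0 :: 'a)"
  by (simp_all add: ring_of_type_algebra_def)

lemma divides_ring_of_type_algebra:
  fixes a b :: "'a::comm_ring_1"
  shows "a divides\<^bsub>ring_of_type_algebra\<^esub> b \<longleftrightarrow> a dvd b"
  by (auto simp: factor_def dvd_def ring_of_type_algebra_simps)

text \<open>A zero \<pi> would make the zero ideal maximal and the ring a field, so \<pi> is a
  nonzero generator of a prime ideal. Every irreducible generates a maximal ideal, by uniqueness
  that of \<pi>; hence \<open>b\<close> divides \<pi> to the number of its irreducible factors. This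
  gives F = A[1/\<pi>].\<close>

lemma
  fixes \<pi> :: "'a::idom"
  assumes "discrete_valuation_ring (ring_of_type_algebra :: 'a ring)"
    and "uniformizer (ring_of_type_algebra :: 'a ring) \<pi>"
  shows prime_elem_uniformizer: "prime_elem \<pi>"
    and dvd_uniformizer_power: "b \<noteq> 0 \<Longrightarrow> \<exists>n. b dvd \<pi> ^ n"
proof -
  define R where "R = (ring_of_type_algebra :: 'a ring)"
  note R = ring_of_type_algebra_simps[where 'a = 'a, folded R_def]
  note dvd = divides_ring_of_type_algebra[where 'a = 'a, folded R_def]
  interpret principal_domain R
    using assms by (simp add: R_def discrete_valuation_ring_def)
  have max: "maximalideal (PIdl\<^bsub>R\<^esub> \<pi>) R"
    and uniq: "\<And>M N. maximalideal M R \<Longrightarrow> maximalideal N R \<Longrightarrow> M = N"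
    and "\<not> Ring.field R"
    using assms by (auto simp: R_def discrete_valuation_ring_def uniformizer_def)
  have "\<pi> \<noteq> 0"
  proof
    assume "\<pi> = 0"
    then have "PIdl\<^bsub>R\<^esub> \<pi> = {\<zero>\<^bsub>R\<^esub>}"
      by (auto simp: cgenideal_def R)
    then show False using max zeromaximalideal_fieldI \<open>\<not> Ring.field R\<close> by simp
  qed
  moreover have "primeideal (PIdl\<^bsub>R\<^esub> \<pi>) R"
    using max by (rule maximalideal_prime)
  ultimately have "ring_prime\<^bsub>R\<^esub> \<pi>"
    using primeideal_iff_prime[of \<pi>] by (simp add: R)
  from ring_primeE[OF _ this] show "prime_elem \<pi>"
    using divides_one[of \<pi>] by (auto simp: prime_elem_def prime_def R dvd)
  show "\<exists>n. b dvd \<pi> ^ n" if "b \<noteq> 0"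
  proof (cases "b \<in> Units R")
    case True
    then show ?thesis using divides_one[of b] by (intro exI[of _ 0]) (simp add: R dvd)
  next
    case False
    then obtain fs where fs: "set fs \<subseteq> carrier (mult_of R)" "wfactors (mult_of R) fs b"
      using factorization_property[of b] \<open>b \<noteq> 0\<close> by (auto simp: R)
    have f: "f dvd \<pi>" if "f \<in> set fs" for f
    proof -
      have "ring_irreducible\<^bsub>R\<^esub> f"
        using that fs ring_irreducibleI'[of f] by (auto simp: wfactors_def)
      then have "PIdl\<^bsub>R\<^esub> f = PIdl\<^bsub>R\<^esub> \<pi>"
        using irreducible_imp_maximalideal[of f] max uniq by (simp add: R)
      then show ?thesis
        using to_contain_is_to_divide[of f \<pi>] by (simp add: R dvd)
    qed
    have "foldr (*) fs 1 dvd \<pi> ^ length fs"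
      using f by (induction fs) (auto intro: mult_dvd_mono)
    moreover have "monoid.mult R = (*)" by (intro ext) (simp add: R)
    then have "b dvd foldr (*) fs 1"
      using fs(2) dvd divides_mult_imp_divides[of R b]
      by (auto simp: wfactors_def associated_def R mult_of_def)
    ultimately show ?thesis by (blast intro: dvd_trans)
  qed
qed

subsection \<open>Laurent polynomials\<close>

text \<open>Reduces identities that are additive in \<open>f\<close> to monomials.\<close>

lemma single_add_induct [case_names zero add]:
  assumes "P 0" "\<And>k c f. P f \<Longrightarrow> P (Poly_Mapping.single k c + f)"
  shows "P (f :: 'k \<Rightarrow>\<^sub>0 'b::comm_monoid_add)"
proof (induction f rule: update_induct)
  case const
  show ?case by (rule assms)
next
  case (update f a b)
  have "Poly_Mapping.update a b f = Poly_Mapping.single a b + f"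
    using update(1)
    by (intro poly_mapping_eqI) (auto simp: lookup_update lookup_add lookup_single in_keys_iff when_def)
  then show ?case using update assms by simp
qed

lemma lookup_mult_keys:
  fixes f g :: "'k::ab_group_add \<Rightarrow>\<^sub>0 'b::comm_ring_1"
  shows "Poly_Mapping.lookup (f * g) k
    = (\<Sum>a\<in>Poly_Mapping.keys f. Poly_Mapping.lookup f a * Poly_Mapping.lookup g (k - a))"
proof -
  have "(\<Sum>q. Poly_Mapping.lookup g q when k = l + q) = Poly_Mapping.lookup g (k - l)" for l
  proof -
    have "(k = l + q) = (q = k - l)" for q by (auto simp: algebra_simps)
    then show ?thesis by simp
  qed
  then show ?thesis
    unfolding lookup_mult
    by (auto intro!: Sum_any.expand_superset simp: in_keys_iff)
qed

lemma lookup_single_0_mult: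
  fixes f :: "'k::ab_group_add \<Rightarrow>\<^sub>0 'b::comm_ring_1"
  shows "Poly_Mapping.lookup (Poly_Mapping.single 0 c * f) k = c * Poly_Mapping.lookup f k"
  by (cases "c = 0") (simp_all add: lookup_mult_keys)

lemma single_0_dvd_iff:
  fixes f :: "'k::ab_group_add \<Rightarrow>\<^sub>0 'b::comm_ring_1"
  shows "Poly_Mapping.single 0 c dvd f \<longleftrightarrow> (\<forall>k. c dvd Poly_Mapping.lookup f k)"
proof
  assume "Poly_Mapping.single 0 c dvd f"
  then show "\<forall>k. c dvd Poly_Mapping.lookup f k"
    by (auto simp: lookup_single_0_mult elim!: dvdE)
next
  assume *: "\<forall>k. c dvd Poly_Mapping.lookup f k"
  \<comment> \<open>The coefficientwise quotient. \<open>Poly_Mapping.map\<close> keeps zero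
    coefficients zero whatever \<open>SOME\<close> selects.\<close>
  let ?g = "Poly_Mapping.map (\<lambda>a. SOME b. a = c * b) f"
  have "f = Poly_Mapping.single 0 c * ?g"
  proof (rule poly_mapping_eqI)
    fix k
    have "\<exists>b. Poly_Mapping.lookup f k = c * b" using * by (auto elim: dvdE)
    from someI_ex[OF this]
    show "Poly_Mapping.lookup f k = Poly_Mapping.lookup (Poly_Mapping.single 0 c * ?g) k"
      by (auto simp: lookup_single_0_mult Poly_Mapping.map.rep_eq when_def)
  qed
  then show "Poly_Mapping.single 0 c dvd f" by (rule dvdI)
qed

section \<open>Gauss's lemma via lexicographically least exponents\<close>

definition lex_le :: "int \<times> int \<Rightarrow> int \<times> int \<Rightarrow> bool" where
  "lex_le a b \<longleftrightarrow> fst a < fst b \<or> fst a = fst b \<and> snd a \<le> snd b"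

lemma ex_lex_least:
  assumes "finite S" "S \<noteq> {}" shows "\<exists>a\<in>S. \<forall>b\<in>S. lex_le a b"
proof -
  define i where "i = Min (fst ` S)"
  define T where "T = {b \<in> S. fst b = i}"
  define j where "j = Min (snd ` T)"
  have "i \<in> fst ` S" using assms by (simp add: i_def)
  then have "finite T" "T \<noteq> {}" using assms by (auto simp: T_def)
  then have "j \<in> snd ` T" by (simp add: j_def)
  then obtain a where "a \<in> S" "fst a = i" "snd a = j" by (auto simp: T_def)
  moreover have "i \<le> fst b" if "b \<in> S" for b using that assms by (simp add: i_def)
  moreover have "j \<le> snd b" if "b \<in> S" "fst b = i" for b
    using that \<open>finite T\<close> by (simp add: j_def T_def)
  ultimately show ?thesis by (force simp: lex_le_def)
qed

text \<open>Gauss's lemma; \<open>\<int> \<times> \<int>\<close> carries no linear order here, so the no-zero-divisors instance of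
  \<open>Poly_Mapping\<close> does not apply.\<close>

lemma prime_elem_single_0:
  fixes c :: "'a::idom"
  assumes "prime_elem c"
  shows "prime_elem (Poly_Mapping.single 0 c :: 'a laurent2)"
proof (rule prime_elemI)
  show "Poly_Mapping.single 0 c \<noteq> (0 :: 'a laurent2)"
    using assms by (metis lookup_single_eq lookup_zero prime_elem_not_zeroI)
  show "\<not> Poly_Mapping.single 0 c dvd (1 :: 'a laurent2)"
    using assms by (metis lookup_one_zero prime_elem_not_unit single_0_dvd_iff)
  fix f g :: "'a laurent2"
  assume fg: "Poly_Mapping.single 0 c dvd f * g"
  have least: "\<exists>a. \<not> c dvd Poly_Mapping.lookup f a \<and>
      (\<forall>b. \<not> c dvd Poly_Mapping.lookup f b \<longrightarrow> lex_le a b)"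
    if "\<not> Poly_Mapping.single 0 c dvd f" for f :: "'a laurent2"
  proof -
    let ?S = "{k. \<not> c dvd Poly_Mapping.lookup f k}"
    have "?S \<subseteq> Poly_Mapping.keys f" by (auto simp: in_keys_iff)
    then have "finite ?S" by (rule finite_subset) simp
    moreover have "?S \<noteq> {}" using that by (auto simp: single_0_dvd_iff)
    ultimately show ?thesis using ex_lex_least[of ?S] by auto
  qed
  show "Poly_Mapping.single 0 c dvd f \<or> Poly_Mapping.single 0 c dvd g"
  proof (rule ccontr)
    assume "\<not> (Poly_Mapping.single 0 c dvd f \<or> Poly_Mapping.single 0 c dvd g)"
    then obtain a b where
      a: "\<not> c dvd Poly_Mapping.lookup f a" "\<And>k. \<not> c dvd Poly_Mapping.lookup f k \<Longrightarrow> lex_le a k" and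
      b: "\<not> c dvd Poly_Mapping.lookup g b" "\<And>k. \<not> c dvd Poly_Mapping.lookup g k \<Longrightarrow> lex_le b k"
      using least[of f] least[of g] by blast
    \<comment> \<open>If \<open>c\<close> divided neither factor, minimality would give k \<ge> a
      and a + b - k \<ge> b lexicographically, so k = a. Thus all terms of the coefficient at
      \<open>a + b\<close> but one are divisible by \<open>c\<close>.\<close>
    have "c dvd Poly_Mapping.lookup f k * Poly_Mapping.lookup g (a + b - k)" if "k \<noteq> a" for k
    proof (rule ccontr)
      assume "\<not> c dvd Poly_Mapping.lookup f k * Poly_Mapping.lookup g (a + b - k)"
      then have "\<not> c dvd Poly_Mapping.lookup f k" "\<not> c dvd Poly_Mapping.lookup g (a + b - k)"
        by auto
      then have "lex_le a k" "lex_le b (a + b - k)" using a b by blast+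
      then show False using that by (auto simp: lex_le_def prod_eq_iff)
    qed
    then have "c dvd (\<Sum>k\<in>Poly_Mapping.keys f - {a}.
        Poly_Mapping.lookup f k * Poly_Mapping.lookup g (a + b - k))"
      by (intro dvd_sum) auto
    moreover have "c dvd Poly_Mapping.lookup (f * g) (a + b)"
      using fg unfolding single_0_dvd_iff by blast
    moreover have "a \<in> Poly_Mapping.keys f" using a(1) by (auto simp: in_keys_iff)
    ultimately have "c dvd Poly_Mapping.lookup f a * Poly_Mapping.lookup g b"
      by (simp add: lookup_mult_keys sum.remove[of _ a] dvd_add_left_iff)
    then show False using assms a b by (simp add: prime_elem_dvd_mult_iff)
  qed
qed

section \<open>Value and first derivatives at (1, 1)\<close>

definition weighted_sum :: "('k \<Rightarrow> 'b) \<Rightarrow> ('k \<Rightarrow>\<^sub>0 'b) \<Rightarrow> 'b::comm_ring_1" where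
  "weighted_sum w f = (\<Sum>k\<in>Poly_Mapping.keys f. w k * Poly_Mapping.lookup f k)"

lemma weighted_sum_single [simp]: "weighted_sum w (Poly_Mapping.single k c) = w k * c"
  by (simp add: weighted_sum_def)

lemma weighted_sum_zero [simp]: "weighted_sum w 0 = 0"
  by (simp add: weighted_sum_def)

lemma weighted_sum_add [simp]: "weighted_sum w (f + g) = weighted_sum w f + weighted_sum w g"
  unfolding weighted_sum_def by (rule setsum_keys_plus_distrib) (simp_all add: algebra_simps)

lemma weighted_sum_diff [simp]: "weighted_sum w (f - g) = weighted_sum w f - weighted_sum w g"
  using weighted_sum_add[of w "f - g" g] by simp

lemma weighted_sum_single_0_mult:
  fixes f :: "'k::ab_group_add \<Rightarrow>\<^sub>0 'b::comm_ring_1"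
  shows "weighted_sum w (Poly_Mapping.single 0 c * f) = c * weighted_sum w f"
  by (induction f rule: single_add_induct) (simp_all add: distrib_left mult_single mult.left_commute)

lemma weighted_sum_1_mult:
  fixes f g :: "'k::ab_group_add \<Rightarrow>\<^sub>0 'b::comm_ring_1"
  shows "weighted_sum (\<lambda>_. 1) (f * g) = weighted_sum (\<lambda>_. 1) f * weighted_sum (\<lambda>_. 1) g"
proof -
  have "weighted_sum (\<lambda>_. 1) (Poly_Mapping.single k c * g) = c * weighted_sum (\<lambda>_. 1) g" for k c
    by (induction g rule: single_add_induct) (simp_all add: distrib_left mult_single)
  then show ?thesis
    by (induction f rule: single_add_induct) (simp_all add: distrib_right)
qed

text \<open>The weights \<open>1\<close>, \<open>i\<close> and \<open>j\<close> at \<open>(i, j)\<close> give the value and the partial derivatives at \<open>(1, 1)\<close>.\<close>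

lemma weighted_sum_fst:
  fixes f :: "(int \<times> int) \<Rightarrow>\<^sub>0 'b::comm_ring_1"
  shows "weighted_sum (\<lambda>k. of_int (fst k)) (f * (Poly_Mapping.single (1, 0) 1 - 1))
      = weighted_sum (\<lambda>_. 1) f"
    "weighted_sum (\<lambda>k. of_int (fst k)) (f * (Poly_Mapping.single (0, 1) 1 - 1)) = 0"
  by (induction f rule: single_add_induct)
    (simp_all add: distrib_right right_diff_distrib mult_single algebra_simps)

lemma weighted_sum_snd:
  fixes f :: "(int \<times> int) \<Rightarrow>\<^sub>0 'b::comm_ring_1"
  shows "weighted_sum (\<lambda>k. of_int (snd k)) (f * (Poly_Mapping.single (0, 1) 1 - 1))
      = weighted_sum (\<lambda>_. 1) f"
    "weighted_sum (\<lambda>k. of_int (snd k)) (f * (Poly_Mapping.single (1, 0) 1 - 1)) = 0"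
  by (induction f rule: single_add_induct)
    (simp_all add: distrib_right right_diff_distrib mult_single algebra_simps)

text \<open>By the product rule, the derivatives of y (Y - 1) - x (X - 1) at (1, 1) in the
  directions Y and X are y(1, 1) and -x(1, 1). So \<open>c\<close> divides both values, hence the
  value 1 of \<open>x * z + y * w\<close>.\<close>

lemma not_unimodular_if_proportional:
  fixes x y :: "(int \<times> int) \<Rightarrow>\<^sub>0 'b::comm_ring_1"
  assumes "Poly_Mapping.single 0 c dvd
      y * (Poly_Mapping.single (0, 1) 1 - 1) - x * (Poly_Mapping.single (1, 0) 1 - 1)"
    and "x * z + y * w = 1"
  shows "c dvd 1"
proof -
  obtain q where q: "y * (Poly_Mapping.single (0, 1) 1 - 1) - x * (Poly_Mapping.single (1, 0) 1 - 1)
      = Poly_Mapping.single 0 c * q"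
    using assms(1) by (elim dvdE)
  have "c dvd weighted_sum (\<lambda>_. 1) y"
    using arg_cong[OF q, of "weighted_sum (\<lambda>k. of_int (snd k))"]
    by (simp add: weighted_sum_snd weighted_sum_single_0_mult)
  moreover have "c dvd - weighted_sum (\<lambda>_. 1) x"
    using arg_cong[OF q, of "weighted_sum (\<lambda>k. of_int (fst k))"]
    by (simp only: weighted_sum_diff weighted_sum_fst weighted_sum_single_0_mult) simp
  ultimately have "c dvd weighted_sum (\<lambda>_. 1) (x * z + y * w)"
    by (simp add: weighted_sum_1_mult)
  moreover have "weighted_sum (\<lambda>_. 1) (1 :: (int \<times> int) \<Rightarrow>\<^sub>0 'b) = 1"
    using weighted_sum_single[of "\<lambda>_. 1 :: 'b" "0 :: int \<times> int" 1]
    by (simp del: weighted_sum_single)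
  ultimately show ?thesis by (simp add: assms(2))
qed

section \<open>Extending coefficients to the fraction field\<close>

definition fract_coeffs :: "('k \<Rightarrow>\<^sub>0 'a::idom) \<Rightarrow> 'k \<Rightarrow>\<^sub>0 'a fract" where
  "fract_coeffs = Poly_Mapping.map (\<lambda>a. Fraction_Field.Fract a 1)"

lemma lookup_fract_coeffs:
  "Poly_Mapping.lookup (fract_coeffs f) k = Fraction_Field.Fract (Poly_Mapping.lookup f k) 1"
  by (simp add: fract_coeffs_def Poly_Mapping.map.rep_eq when_def Zero_fract_def)

lemma fract_coeffs_single [simp]:
  "fract_coeffs (Poly_Mapping.single k c) = Poly_Mapping.single k (Fraction_Field.Fract c 1)"
  by (rule poly_mapping_eqI) (simp add: lookup_fract_coeffs lookup_single when_def Zero_fract_def)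

lemma fract_coeffs_zero [simp]: "fract_coeffs 0 = 0"
  by (rule poly_mapping_eqI) (simp add: lookup_fract_coeffs Zero_fract_def)

lemma fract_coeffs_add [simp]: "fract_coeffs (f + g) = fract_coeffs f + fract_coeffs g"
  by (rule poly_mapping_eqI) (simp add: lookup_fract_coeffs lookup_add)

lemma fract_coeffs_diff [simp]: "fract_coeffs (f - g) = fract_coeffs f - fract_coeffs g"
  using fract_coeffs_add[of "f - g" g] by simp

lemma fract_coeffs_uminus [simp]: "fract_coeffs (- f) = - fract_coeffs f"
  using fract_coeffs_diff[of 0 f] by simp

lemma fract_coeffs_mult [simp]:
  fixes f g :: "'k::ab_group_add \<Rightarrow>\<^sub>0 'a::idom"
  shows "fract_coeffs (f * g) = fract_coeffs f * fract_coeffs g"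
proof -
  have "fract_coeffs (Poly_Mapping.single k c * g)
      = fract_coeffs (Poly_Mapping.single k c) * fract_coeffs g" for k c
    by (induction g rule: single_add_induct) (simp_all add: distrib_left mult_single)
  then show ?thesis
    by (induction f rule: single_add_induct) (simp_all add: distrib_right del: fract_coeffs_single)
qed

lemma fract_coeffs_one [simp]: "fract_coeffs (1 :: 'k::ab_group_add \<Rightarrow>\<^sub>0 'a::idom) = 1"
  using fract_coeffs_single[of "0 :: 'k" "1 :: 'a"]
  by (simp del: fract_coeffs_single flip: One_fract_def)

lemma inj_fract_coeffs: "inj fract_coeffs"
  by (rule injI, rule poly_mapping_eqI)
    (metis eq_fract(1) lookup_fract_coeffs mult.right_neutral zero_neq_one)

text \<open>Denominators are cleared one monomial at a time: for a coefficient a/b, \<open>b\<close>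
  divides a power of \<pi>, and the exponents add up.\<close>

lemma fract_coeffs_denominator:
  fixes \<pi> :: "'a::idom" and r :: "'k::ab_group_add \<Rightarrow>\<^sub>0 'a fract"
  assumes dvd: "\<And>b. b \<noteq> 0 \<Longrightarrow> \<exists>n. b dvd \<pi> ^ n"
  shows "\<exists>n s. fract_coeffs (Poly_Mapping.single 0 \<pi>) ^ n * r = fract_coeffs s"
proof (induction r rule: single_add_induct)
  case zero
  show ?case by (intro exI[of _ "0::nat"] exI[of _ "0 :: 'k \<Rightarrow>\<^sub>0 'a"]) simp
next
  case (add k c r)
  let ?p = "fract_coeffs (Poly_Mapping.single 0 \<pi>) :: 'k \<Rightarrow>\<^sub>0 'a fract"
  have power: "Poly_Mapping.single (0 :: 'k) (Fraction_Field.Fract \<pi> 1) ^ n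
      = Poly_Mapping.single 0 (Fraction_Field.Fract (\<pi> ^ n) 1)" for n
    by (induction n) (simp_all add: mult_single flip: One_fract_def)
  obtain n s where s: "?p ^ n * r = fract_coeffs s" using add by blast
  obtain a b where c: "c = Fraction_Field.Fract a b" "b \<noteq> 0" by (cases c)
  then obtain m d where "\<pi> ^ m = b * d" using dvd by (blast elim: dvdE)
  moreover from this have "Fraction_Field.Fract (b * d * a) b = Fraction_Field.Fract (d * a) 1"
    using c by (simp add: eq_fract)
  ultimately have "?p ^ m * Poly_Mapping.single k c = fract_coeffs (Poly_Mapping.single k (d * a))"
    using c by (simp add: power mult_single)
  moreover have "?p ^ (n + m) * (Poly_Mapping.single k c + r)
      = ?p ^ n * (?p ^ m * Poly_Mapping.single k c) + ?p ^ m * (?p ^ n * r)"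
    by (simp add: power_add algebra_simps)
  ultimately have "?p ^ (n + m) * (Poly_Mapping.single k c + r)
      = ?p ^ n * fract_coeffs (Poly_Mapping.single k (d * a)) + ?p ^ m * fract_coeffs s"
    by (simp only: s)
  also have "\<dots> = fract_coeffs (Poly_Mapping.single 0 (\<pi> ^ n) * Poly_Mapping.single k (d * a)
      + Poly_Mapping.single 0 (\<pi> ^ m) * s)"
    by (simp add: power)
  finally show ?case by blast
qed

subsection \<open>The matrix \<open>M\<^sub>\<pi>\<close>\<close>

theorem theorem1:
  fixes \<pi> :: "'a::idom"
  assumes "discrete_valuation_ring (ring_of_type_algebra :: 'a ring)"
    and "uniformizer (ring_of_type_algebra :: 'a ring) \<pi>"
  shows "M_pi \<pi> \<in> carrier SL2 \<and> M_pi \<pi> \<notin> E2"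
proof
  show "M_pi \<pi> \<in> carrier SL2"
    by (simp add: M_pi_def SL2_def det_2 Let_def power2_eq_square algebra_simps)
  define u :: "'a laurent2" where "u = Poly_Mapping.single (1, 0) 1 - 1"
  define v :: "'a laurent2" where "v = Poly_Mapping.single (0, 1) 1 - 1"
  define p :: "'a laurent2" where "p = Poly_Mapping.single 0 \<pi>"
  note \<pi> = prime_elem_uniformizer[OF assms] dvd_uniformizer_power[OF assms]
  have prime: "prime_elem p" unfolding p_def using \<pi>(1) by (rule prime_elem_single_0)
  interpret localization_hom fract_coeffs p
  proof
    show "a = b" if "p * a = p * b" for a b
    proof (rule poly_mapping_eqI)
      fix k
      have "\<pi> * Poly_Mapping.lookup a k = \<pi> * Poly_Mapping.lookup b k"
        using that by (metis p_def lookup_single_0_mult)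
      then show "Poly_Mapping.lookup a k = Poly_Mapping.lookup b k"
        using \<pi>(1) by simp
    qed
  qed (simp_all add: prime[unfolded p_def] inj_fract_coeffs p_def
      fract_coeffs_denominator[OF \<pi>(2), simplified])
  \<comment> \<open>A coefficient equal to 1 is not divisible by the nonunit \<pi>.\<close>
  have "Poly_Mapping.lookup u (1, 0) = 1"
    by (simp add: u_def lookup_minus lookup_single lookup_one when_def zero_prod_def)
  then have u: "\<not> p dvd u"
    using \<pi>(1) unfolding p_def single_0_dvd_iff by (metis prime_elem_not_unit)
  \<comment> \<open>This is \<pi> times the given matrix; the entry \<open>- (u ^ 2)\<close> shows
    that it is not divisible by \<open>p\<close>.\<close>
  define H where "H = mat2 (p - u * v) (v ^ 2) (- (u ^ 2)) (p + u * v)"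
  show "M_pi \<pi> \<notin> E2"
  proof
    assume E2: "M_pi \<pi> \<in> E2"
    have lX: "fract_coeffs u = lX - 1" and lY: "fract_coeffs v = lY - 1"
      by (simp_all add: u_def v_def lX_def lY_def flip: One_fract_def)
    have "Fraction_Field.Fract \<pi> \<pi> = 1"
      using \<pi>(1) by (auto simp: One_fract_def eq_fract)
    then have "fract_coeffs p * lconst (Fraction_Field.Fract 1 \<pi>) = 1"
      by (simp add: p_def lconst_def mult_single flip: zero_prod_def)
    then have cancel: "fract_coeffs p * (lconst (Fraction_Field.Fract 1 \<pi>) * f) = f" for f
      by (simp flip: mult.assoc)
    have "mat (fract_coeffs p ^ 1) ** M_pi \<pi> = map_mat fract_coeffs H"
      by (simp add: vec_eq_iff forall_2 mat_mult_nth H_def M_pi_def Let_def cancel mult.assoc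
          distrib_left right_diff_distrib power2_eq_square flip: lX lY)
    moreover have "\<not> p dvd H $ 2 $ 1"
      using u prime by (simp add: H_def power2_eq_square prime_elem_dvd_mult_iff)
    ultimately have red: "reduced p H" using E2 by (intro E2_primitive_reduced)
    have "det H = p * p" by (simp add: H_def det_2 algebra_simps power2_eq_square)
    \<comment> \<open>Excludes the path of length 0, so that a factor \<open>D\<close>
      occurs.\<close>
    then have "det H \<noteq> 1" using prime by (metis dvd_triv_left prime_elem_not_unit)
    with red obtain x y z w where xy: "x * z + y * w = 1"
      and col: "\<And>j. p dvd y * H $ 1 $ j - x * H $ 2 $ j"
      by (rule reduced_unimodular_column) blast
    \<comment> \<open>Modulo \<open>p\<close> the first column of \<open>H\<close> is -u times (v,
      u), and the factor \<open>u\<close> can be cancelled because the prime \<open>p\<close> does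
      not divide it.\<close>
    have "u * (y * v - x * u) = p * y - (y * H $ 1 $ 1 - x * H $ 2 $ 1)"
      by (simp add: H_def algebra_simps power2_eq_square)
    then have "p dvd u * (y * v - x * u)" using col by simp
    then have "p dvd y * v - x * u" using u prime by (simp add: prime_elem_dvd_mult_iff)
    then have "\<pi> dvd 1"
      unfolding p_def u_def v_def using xy by (rule not_unimodular_if_proportional)
    then show False using prime_elem_not_unit[OF \<pi>(1)] by simp
  qed
qed

end
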